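(* Let $G$ be a connected finite simple graph of order $n\ge 2$ and let $H$ be an arbitrary finite simple graph of order at least two. Then $$2\rho(G)\le L_2(G\circ H)\le 2\big(n-\Delta(G)\big).$$
   Context: $N[v]=N(v)\cup\{v\}$ is the closed neighborhood of $v$, and $\Delta(G)$ is the maximum degree of $G$. A set $B\subseteq V(G)$ is a packing if $N[u]\cap N[v]=\emptyset$ for all distinct $u,v\in B$; the packing number $\rho(G)$ is the maximum cardinality of a packing in $G$. A set $B\subseteq V(G)$ is a $2$-limited packing if $|B\cap N[v]|\le2$ for every $v\in V(G)$; $L_2(G)$ is the maximum cardinality of a $2$-limited packing in $G$. The lexicographic product $G\circ H$ has vertex set $V(G)\times V(H)$, and two vertices $(g,h)$ and $(g',h')$ are adjacent if either $gg'\in E(G)$, or $g=g'$ and $hh'\in E(H)$. *)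

theory Defs
  imports "Graph_Theory.Graph_Theory"
begin

text \<open>
  A finite simple graph is a \<^typ>\<open>'a pair_pre_digraph\<close> satisfying \<^const>\<open>pair_graph\<close>:
  an undirected edge \<open>uv\<close> is the pair of arcs \<open>(u, v)\<close>, \<open>(v, u)\<close>.
\<close>

definition nbhd :: "'a pair_pre_digraph \<Rightarrow> 'a \<Rightarrow> 'a set" where
  "nbhd G v = {u \<in> pverts G. (v, u) \<in> parcs G}"

definition closed_nbhd :: "'a pair_pre_digraph \<Rightarrow> 'a \<Rightarrow> 'a set" where
  "closed_nbhd G v = nbhd G v \<union> {v}"

text \<open>
  The maxima below are \<^const>\<open>Max\<close> of a finite set when the graph is finite; the set is nonempty
  for the two packing numbers (the empty set qualifies), and for the maximum degree as soon as
  the graph has a vertex.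
\<close>

definition max_degree :: "'a pair_pre_digraph \<Rightarrow> nat" where
  "max_degree G = Max {card (nbhd G v) |v. v \<in> pverts G}"

definition is_packing :: "'a pair_pre_digraph \<Rightarrow> 'a set \<Rightarrow> bool" where
  "is_packing G B \<longleftrightarrow> B \<subseteq> pverts G \<and>
     (\<forall>u\<in>B. \<forall>v\<in>B. u \<noteq> v \<longrightarrow> closed_nbhd G u \<inter> closed_nbhd G v = {})"

definition packing_number :: "'a pair_pre_digraph \<Rightarrow> nat" where
  "packing_number G = Max {card B |B. is_packing G B}"

definition is_2_limited_packing :: "'a pair_pre_digraph \<Rightarrow> 'a set \<Rightarrow> bool" where
  "is_2_limited_packing G B \<longleftrightarrow> B \<subseteq> pverts G \<and>
     (\<forall>v\<in>pverts G. card (B \<inter> closed_nbhd G v) \<le> 2)"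

definition two_limited_packing_number :: "'a pair_pre_digraph \<Rightarrow> nat" where
  "two_limited_packing_number G = Max {card B |B. is_2_limited_packing G B}"

definition lex_product ::
    "'a pair_pre_digraph \<Rightarrow> 'b pair_pre_digraph \<Rightarrow> ('a \<times> 'b) pair_pre_digraph" where
  "lex_product G H = \<lparr>
     pverts = pverts G \<times> pverts H,
     parcs = {((g, h), (g', h')) |g h g' h'.
       (g, h) \<in> pverts G \<times> pverts H \<and> (g', h') \<in> pverts G \<times> pverts H \<and>
       ((g, g') \<in> parcs G \<or> (g = g' \<and> (h, h') \<in> parcs H))} \<rparr>"

lemma pair_graph_lex_product:
  assumes "pair_graph G" and "pair_graph H"
  shows "pair_graph (lex_product G H)"
proof -
  interpret G: pair_graph G by fact
  interpret H: pair_graph H by fact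
  have fin: "finite (pverts G \<times> pverts H)"
    using G.pair_finite_verts H.pair_finite_verts by simp
  have sub: "parcs (lex_product G H) \<subseteq> (pverts G \<times> pverts H) \<times> (pverts G \<times> pverts H)"
    by (auto simp: lex_product_def)
  show ?thesis
  proof
    show "fst e \<in> pverts (lex_product G H)" if "e \<in> parcs (lex_product G H)" for e
      using that by (auto simp: lex_product_def)
    show "snd e \<in> pverts (lex_product G H)" if "e \<in> parcs (lex_product G H)" for e
      using that by (auto simp: lex_product_def)
    show "finite (pverts (lex_product G H))"
      using fin by (simp add: lex_product_def)
    show "finite (parcs (lex_product G H))"
      using finite_subset[OF sub] fin by blast
    show "fst e \<noteq> snd e" if "e \<in> parcs (lex_product G H)" for e
      using that by (auto simp: lex_product_def dest: G.no_loops' H.no_loops')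
    show "symmetric (with_proj (lex_product G H))"
      unfolding symmetric_def
      by (rule symI) (auto simp: lex_product_def dest: G.arcs_symmetric H.arcs_symmetric)
  qed
qed

end

theory Submission
  imports Defs
begin

text \<open>
  Write the vertex set of \<open>G \<circ> H\<close> as a disjoint union of the layers \<open>{g} \<times> V(H)\<close>.

  Lower bound: if \<open>B\<close> is a packing of \<open>G\<close>, no closed neighbourhood of \<open>G\<close> contains two
  elements of \<open>B\<close>. A closed neighbourhood of \<open>G \<circ> H\<close> lies over a closed neighbourhood
  of \<open>G\<close>, so placing two vertices on every layer over \<open>B\<close> gives a \<open>2\<close>-limited packing.

  Upper bound: a vertex of \<open>G \<circ> H\<close> is adjacent to every vertex of every neighbouring layer. Hence
  a \<open>2\<close>-limited packing \<open>B\<close> contains at most two vertices on all the layers over a closed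
  neighbourhood \<open>N[v]\<close> taken together, provided that \<open>v\<close> has a neighbour; this is
  \<open>card_over_closed_nbhd_le_2\<close>. In particular each layer contains at most two vertices
  of \<open>B\<close>. Taking \<open>v\<close> of maximum degree, the \<open>\<Delta>(G) + 1\<close> layers over \<open>N[v]\<close> contribute at most
  two vertices in total, and each of the other \<open>n - \<Delta>(G) - 1\<close> layers at most two, which adds up
  to \<open>2(n - \<Delta>(G))\<close>. Every vertex has a neighbour because \<open>G\<close> is connected of order at least two.
\<close>

section \<open>Maximum cardinalities and neighbourhoods\<close>

lemma card_le_Max_card:
  assumes "finite V" and "\<And>B. P B \<Longrightarrow> B \<subseteq> V" and "P B"
  shows "card B \<le> Max {card B |B. P B}"
proof (rule Max_ge)
  have "{card B |B. P B} \<subseteq> card ` Pow V"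
    using assms(2) by auto
  then show "finite {card B |B. P B}"
    using assms(1) finite_subset by blast
qed (use assms(3) in blast)

lemma Max_card_attained:
  assumes "finite V" and "\<And>B. P B \<Longrightarrow> B \<subseteq> V" and "P A"
  obtains B where "P B" and "card B = Max {card B |B. P B}"
proof -
  have "{card B |B. P B} \<subseteq> card ` Pow V"
    using assms(2) by auto
  then have "finite {card B |B. P B}"
    using assms(1) finite_subset by blast
  moreover have "{card B |B. P B} \<noteq> {}"
    using assms(3) by blast
  ultimately have "Max {card B |B. P B} \<in> {card B |B. P B}"
    by (rule Max_in)
  then show thesis
    using that by force
qed

lemma pverts_lex_product [simp]: "pverts (lex_product G H) = pverts G \<times> pverts H"
  by (simp add: lex_product_def)

lemma mem_closed_nbhd_lex_product:
  assumes "(g, h) \<in> pverts G \<times> pverts H"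
  shows "(g', h') \<in> closed_nbhd (lex_product G H) (g, h) \<longleftrightarrow>
    g' \<in> pverts G \<and> h' \<in> pverts H \<and>
    ((g, g') \<in> parcs G \<or> g' = g \<and> ((h, h') \<in> parcs H \<or> h' = h))"
  using assms by (auto simp: closed_nbhd_def nbhd_def lex_product_def)

lemma (in pair_graph) closed_nbhd_sym:
  assumes "u \<in> pverts G" and "v \<in> closed_nbhd G u"
  shows "u \<in> closed_nbhd G v"
  using assms arcs_symmetric by (auto simp: closed_nbhd_def nbhd_def)

lemma (in pair_graph) card_closed_nbhd:
  "card (closed_nbhd G v) = Suc (card (nbhd G v))"
proof -
  have "finite (nbhd G v)" and "v \<notin> nbhd G v"
    using pair_finite_verts no_loops' by (auto simp: nbhd_def)
  then show ?thesis
    by (simp add: closed_nbhd_def)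
qed

lemma (in pair_graph) connected_imp_has_neighbour:
  assumes "Digraph_Component.connected (with_proj G)" and "card (pverts G) \<ge> 2"
    and "v \<in> pverts G"
  obtains u where "(v, u) \<in> parcs G"
proof -
  have "\<not> card (pverts G) \<le> Suc 0"
    using assms(2) by simp
  then obtain w where w: "w \<in> pverts G" "w \<noteq> v"
    using assms(3) pair_finite_verts by (metis card_le_Suc0_iff_eq)
  have "strongly_connected (with_proj G)"
    using assms(1) symmetric_connected_imp_strongly_connected[OF sym_arcs] by simp
  then have "v \<rightarrow>\<^sup>*\<^bsub>with_proj G\<^esub> w"
    using assms(3) w by (auto elim: strongly_connectedE)
  then show thesis
    using w(2) that by (cases rule: converse_reachable_cases) auto
qed

section \<open>The lower bound\<close>

text \<open>
  A vertex \<open>g\<close> whose closed neighbourhood contained two elements of a packing would belong to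
  the closed neighbourhoods of both of them.
\<close>

lemma (in pair_graph) card_packing_inter_closed_nbhd:
  assumes B: "is_packing G B" and g: "g \<in> pverts G"
  shows "card (B \<inter> closed_nbhd G g) \<le> 1"
proof -
  have "u = v" if "u \<in> B \<inter> closed_nbhd G g" "v \<in> B \<inter> closed_nbhd G g" for u v
    using that B closed_nbhd_sym[OF g] unfolding is_packing_def by blast
  moreover have "finite (B \<inter> closed_nbhd G g)"
    using B pair_finite_verts finite_subset unfolding is_packing_def by blast
  ultimately show ?thesis
    by (metis One_nat_def card_le_Suc0_iff_eq)
qed

text \<open>
  Over a closed neighbourhood of \<open>G \<circ> H\<close> there is at most one element of \<open>B\<close>, and it carries only
  the two vertices chosen by \<open>K\<close>.
\<close>

lemma two_limited_packing_of_packing: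
  assumes "pair_graph G" and B: "is_packing G B"
    and K: "K \<subseteq> pverts H" "card K = 2"
  shows "is_2_limited_packing (lex_product G H) (B \<times> K)"
proof -
  interpret G: pair_graph G by fact
  have BV: "B \<subseteq> pverts G"
    using B by (simp add: is_packing_def)
  have finK: "finite K"
    using K(2) card.infinite by fastforce
  have "card (B \<times> K \<inter> closed_nbhd (lex_product G H) (g, h)) \<le> 2"
    if gh: "g \<in> pverts G" "h \<in> pverts H" for g h
  proof -
    have "B \<times> K \<inter> closed_nbhd (lex_product G H) (g, h) \<subseteq> (B \<inter> closed_nbhd G g) \<times> K"
      using gh by (auto simp: mem_closed_nbhd_lex_product closed_nbhd_def[of G] nbhd_def[of G])
    moreover have "finite ((B \<inter> closed_nbhd G g) \<times> K)"
      using BV G.pair_finite_verts finK by (meson finite_Int finite_SigmaI finite_subset)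
    ultimately have "card (B \<times> K \<inter> closed_nbhd (lex_product G H) (g, h))
        \<le> card ((B \<inter> closed_nbhd G g) \<times> K)"
      by (rule card_mono[rotated])
    also have "\<dots> \<le> 2"
      using G.card_packing_inter_closed_nbhd[OF B gh(1)] K(2)
      by (simp add: card_cartesian_product)
    finally show ?thesis .
  qed
  then show ?thesis
    using BV K(1) by (auto simp: is_2_limited_packing_def)
qed

lemma twice_packing_number_le:
  assumes "pair_graph G" and "pair_graph H" and "card (pverts H) \<ge> 2"
  shows "2 * packing_number G \<le> two_limited_packing_number (lex_product G H)"
proof -
  interpret G: pair_graph G by fact
  interpret H: pair_graph H by fact
  obtain B where B: "is_packing G B" "card B = packing_number G"
    unfolding packing_number_def
    by (rule Max_card_attained[of "pverts G" "is_packing G" "{}"])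
       (use G.pair_finite_verts in \<open>auto simp: is_packing_def\<close>)
  obtain K where K: "K \<subseteq> pverts H" "card K = 2"
    using assms(3) by (meson obtain_subset_with_card_n)
  have "card (B \<times> K) \<le> two_limited_packing_number (lex_product G H)"
    unfolding two_limited_packing_number_def
  proof (rule card_le_Max_card)
    show "finite (pverts G \<times> pverts H)"
      using G.pair_finite_verts H.pair_finite_verts by simp
    show "is_2_limited_packing (lex_product G H) (B \<times> K)"
      by (rule two_limited_packing_of_packing[OF assms(1) B(1) K])
  qed (auto simp: is_2_limited_packing_def)
  then show ?thesis
    using B(2) K(2) by (simp add: card_cartesian_product)
qed

section \<open>The upper bound\<close>

text \<open>
  The closed neighbourhood of \<open>(v, h)\<close> contains all layers over \<open>N(v)\<close>, but on the layer of \<open>v\<close>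
  it is only certain to contain \<open>(v, h)\<close>. If \<open>B\<close> has at most one vertex on that layer, some choice
  of \<open>h\<close> therefore captures everything. If \<open>B\<close> has two vertices there, they fill the closed
  neighbourhood of every vertex over \<open>N(v)\<close>, which leaves no room for an element of \<open>B\<close> over \<open>N(v)\<close>.
\<close>

lemma card_over_closed_nbhd_le_2:
  assumes "pair_graph G" and "pair_graph H" and "pverts H \<noteq> {}"
    and B: "is_2_limited_packing (lex_product G H) B"
    and vw: "(v, w) \<in> parcs G"
  shows "card (B \<inter> closed_nbhd G v \<times> pverts H) \<le> 2"
proof -
  interpret G: pair_graph G by fact
  interpret H: pair_graph H by fact
  let ?N = "closed_nbhd (lex_product G H)"
  let ?T = "B \<inter> closed_nbhd G v \<times> pverts H"
  have BV: "B \<subseteq> pverts G \<times> pverts H"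
    using B by (simp add: is_2_limited_packing_def)
  have finB: "finite B"
    using BV G.pair_finite_verts H.pair_finite_verts by (meson finite_SigmaI finite_subset)
  have v: "v \<in> pverts G" and w: "w \<in> pverts G"
    using vw G.wellformed by force+
  have bound: "card S \<le> 2" if "S \<subseteq> B \<inter> ?N (g, h)" "g \<in> pverts G" "h \<in> pverts H" for S g h
  proof -
    have "card S \<le> card (B \<inter> ?N (g, h))"
      using that(1) finB by (intro card_mono) auto
    also have "\<dots> \<le> 2"
      using B that(2,3) by (auto simp: is_2_limited_packing_def)
    finally show ?thesis .
  qed
  show ?thesis
  proof (cases "\<exists>h\<in>pverts H. \<forall>k. (v, k) \<in> B \<longrightarrow> k = h")
    case True
    then obtain h where h: "h \<in> pverts H" "\<And>k. (v, k) \<in> B \<Longrightarrow> k = h"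
      by blast
    have "?T \<subseteq> B \<inter> ?N (v, h)"
      using h v by (auto simp: mem_closed_nbhd_lex_product closed_nbhd_def[of G] nbhd_def[of G])
    then show ?thesis
      using v h(1) by (rule bound)
  next
    case False
    obtain h1 where h1: "(v, h1) \<in> B"
      using False assms(3) by blast
    then obtain h2 where h2: "(v, h2) \<in> B" "h2 \<noteq> h1"
      using False BV by blast
    have no_nbr: "(u, k) \<notin> B" if vu: "(v, u) \<in> parcs G" for u k
    proof
      assume uk: "(u, k) \<in> B"
      have "(u, v) \<in> parcs G"
        using vu G.arcs_symmetric by blast
      then have "{(v, h1), (v, h2), (u, k)} \<subseteq> B \<inter> ?N (u, k)"
        using uk h1 h2 BV by (auto simp: mem_closed_nbhd_lex_product subset_iff)
      then have "card {(v, h1), (v, h2), (u, k)} \<le> 2"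
        using bound uk BV by blast
      moreover have "u \<noteq> v"
        using vu G.no_loops' by blast
      ultimately show False
        using h2(2) by simp
    qed
    obtain h where h: "h \<in> pverts H"
      using assms(3) by blast
    have "(w, v) \<in> parcs G"
      using vw G.arcs_symmetric by blast
    then have "?T \<subseteq> B \<inter> ?N (w, h)"
      using no_nbr v w h
      by (auto simp: mem_closed_nbhd_lex_product closed_nbhd_def[of G] nbhd_def[of G])
    then show ?thesis
      using w h by (rule bound)
  qed
qed

text \<open>
  The layers over \<open>N[v]\<close> share a budget of two vertices, and the remaining layers are counted one
  by one. The bound holds at every vertex \<open>v\<close> and is strongest when the degree of \<open>v\<close> is maximum.
\<close>

lemma card_two_limited_packing_le:
  assumes "pair_graph G" and "pair_graph H" and "pverts H \<noteq> {}"
    and no_isolated: "\<And>g. g \<in> pverts G \<Longrightarrow> \<exists>u. (g, u) \<in> parcs G"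
    and B: "is_2_limited_packing (lex_product G H) B"
    and v: "v \<in> pverts G"
  shows "card B \<le> 2 * (card (pverts G) - card (nbhd G v))"
proof -
  interpret G: pair_graph G by fact
  interpret H: pair_graph H by fact
  let ?R = "pverts G - closed_nbhd G v"
  have BV: "B \<subseteq> pverts G \<times> pverts H"
    using B by (simp add: is_2_limited_packing_def)
  have finB: "finite B"
    using BV G.pair_finite_verts H.pair_finite_verts by (meson finite_SigmaI finite_subset)
  have over_nbhd: "card (B \<inter> closed_nbhd G g \<times> pverts H) \<le> 2" if "g \<in> pverts G" for g
    using card_over_closed_nbhd_le_2[OF assms(1-3) B] no_isolated[OF that] by blast
  have layer: "card (B \<inter> {g} \<times> pverts H) \<le> 2" if "g \<in> pverts G" for g
  proof -
    have "card (B \<inter> {g} \<times> pverts H) \<le> card (B \<inter> closed_nbhd G g \<times> pverts H)"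
      using finB by (intro card_mono) (auto simp: closed_nbhd_def)
    then show ?thesis
      using over_nbhd[OF that] by simp
  qed
  have sub: "closed_nbhd G v \<subseteq> pverts G"
    using v by (auto simp: closed_nbhd_def nbhd_def)
  have card_R: "card ?R = card (pverts G) - Suc (card (nbhd G v))"
    using sub G.pair_finite_verts
    by (metis G.card_closed_nbhd card_Diff_subset finite_subset)
  have pos: "Suc (card (nbhd G v)) \<le> card (pverts G)"
    using card_mono[OF G.pair_finite_verts sub] by (simp add: G.card_closed_nbhd)
  have "B = (B \<inter> closed_nbhd G v \<times> pverts H) \<union> (\<Union>g\<in>?R. B \<inter> {g} \<times> pverts H)"
    using BV by auto
  then have "card B \<le> card (B \<inter> closed_nbhd G v \<times> pverts H)
      + card (\<Union>g\<in>?R. B \<inter> {g} \<times> pverts H)"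
    by (metis card_Un_le)
  also have "\<dots> \<le> 2 + (\<Sum>g\<in>?R. card (B \<inter> {g} \<times> pverts H))"
    using over_nbhd[OF v] G.pair_finite_verts by (intro add_mono card_UN_le) auto
  also have "\<dots> \<le> 2 + card ?R * 2"
    using sum_bounded_above[of ?R "\<lambda>g. card (B \<inter> {g} \<times> pverts H)" 2] layer by simp
  also have "\<dots> = 2 * (card (pverts G) - card (nbhd G v))"
    using card_R pos by simp
  finally show ?thesis .
qed

lemma max_degree_attained:
  assumes "finite (pverts G)" and "pverts G \<noteq> {}"
  obtains v where "v \<in> pverts G" and "card (nbhd G v) = max_degree G"
proof -
  have "max_degree G \<in> {card (nbhd G v) |v. v \<in> pverts G}"
    unfolding max_degree_def using assms by (intro Max_in) auto
  then show thesis
    using that by force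
qed

theorem theorem3p5:
  fixes G :: "'a pair_pre_digraph" and H :: "'b pair_pre_digraph" and n :: nat
  assumes "pair_graph G" and "Digraph_Component.connected (with_proj G)"
    and "n = card (pverts G)" and "n \<ge> 2"
    and "pair_graph H" and "card (pverts H) \<ge> 2"
  shows "2 * packing_number G \<le> two_limited_packing_number (lex_product G H) \<and>
         int (two_limited_packing_number (lex_product G H)) \<le> 2 * (int n - int (max_degree G))"
proof
  interpret G: pair_graph G by fact
  interpret H: pair_graph H by fact
  show "2 * packing_number G \<le> two_limited_packing_number (lex_product G H)"
    by (rule twice_packing_number_le[OF assms(1,5,6)])
  have nonempty: "pverts G \<noteq> {}" "pverts H \<noteq> {}"
    using assms(3,4,6) by auto
  obtain v where v: "v \<in> pverts G" "card (nbhd G v) = max_degree G"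
    using max_degree_attained[OF G.pair_finite_verts nonempty(1)] .
  obtain B where B: "is_2_limited_packing (lex_product G H) B"
      "card B = two_limited_packing_number (lex_product G H)"
    unfolding two_limited_packing_number_def
    by (rule Max_card_attained[of "pverts G \<times> pverts H" "is_2_limited_packing (lex_product G H)" "{}"])
       (use G.pair_finite_verts H.pair_finite_verts in \<open>auto simp: is_2_limited_packing_def\<close>)
  have "\<exists>u. (g, u) \<in> parcs G" if "g \<in> pverts G" for g
    using G.connected_imp_has_neighbour[OF assms(2) _ that] assms(3,4) by blast
  then have "card B \<le> 2 * (n - max_degree G)"
    using card_two_limited_packing_le[OF assms(1,5) nonempty(2) _ B(1) v(1)] v(2) assms(3)
    by simp
  \<comment> \<open>Turns the truncated difference of natural numbers into the difference of integers.\<close>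
  moreover have "max_degree G \<le> n"
    unfolding v(2)[symmetric] assms(3)
    using G.pair_finite_verts by (intro card_mono) (auto simp: nbhd_def)
  ultimately show "int (two_limited_packing_number (lex_product G H))
      \<le> 2 * (int n - int (max_degree G))"
    using B(2) by simp
qed

end
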